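(* Let $1<\gamma<2$, let $X=\{-1,1\}^{\{1,2,3,\dots\}}$ and consider the potential $A:X\to\mathbb R$, $A(x)=\sum_{j=1}^{\infty}j^{-\gamma}x_1x_{j+1}$. Let $\widetilde X$ be the set of all $x\in X$ for which there is $N$ such that $x_j=-x_{j+1}$ for all $j\ge N$. Then there exists a non-negative function $\widetilde\varphi:\widetilde X\to\mathbb R$ such that for every $x\in\widetilde X$ $$\mathscr L_A(\widetilde\varphi)(x)=\lambda_A\,\widetilde\varphi(x),$$ where $\lambda_A$ is the spectral radius of the Ruelle operator $\mathscr L_A$ acting on $C(X)$.
   Context: The Ruelle operator is $\mathscr L_A(f)(x)=\sum_{i\in\{-1,1\}}e^{A(i,x_1,x_2,\dots)}f(i,x_1,x_2,\dots)$; on $C(X)$ (real continuous functions, supremum norm) it is a bounded operator. The set $\widetilde X$ is dense in $X$ and contains all preimages under the shift of its points, i.e. $x\in\widetilde X$ implies $(i,x_1,x_2,\dots)\in\widetilde X$ for $i=\pm1$, so the same formula defines $\mathscr L_A(f)(x)$ for $f:\widetilde X\to\mathbb R$ and $x\in\widetilde X$. *)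

theory Defs
  imports "HOL-Analysis.Analysis"
begin

typedef spin = "{-1, 1 :: real}"
  morphisms spin_val Spin
  by auto

lemma spin_val_cases: "spin_val s = -1 \<or> spin_val s = 1"
  using spin_val[of s] by auto

lemma UNIV_spin: "(UNIV :: spin set) = {Spin (-1), Spin 1}"
  using type_definition.univ[OF type_definition_spin] by simp

instance spin :: finite
  by standard (simp add: UNIV_spin)

instantiation spin :: metric_space
begin

definition dist_spin :: "spin \<Rightarrow> spin \<Rightarrow> real"
  where "dist_spin s t = dist (spin_val s) (spin_val t)"

definition uniformity_spin :: "(spin \<times> spin) filter"
  where "uniformity_spin = (INF e\<in>{0<..}. principal {(s, t). dist s t < e})"

definition open_spin :: "spin set \<Rightarrow> bool"
  where "open_spin U = (\<forall>s\<in>U. \<forall>\<^sub>F (s', t) in uniformity. s' = s \<longrightarrow> t \<in> U)"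

instance
proof
  fix s t u :: spin
  show "dist s t = 0 \<longleftrightarrow> s = t"
    by (simp add: dist_spin_def spin_val_inject)
  show "dist s t \<le> dist s u + dist t u"
    unfolding dist_spin_def by (rule dist_triangle2)
qed (simp_all add: uniformity_spin_def open_spin_def)

end

instance spin :: discrete_topology
proof
  fix U :: "spin set"
  show "open U"
    unfolding open_dist
  proof (intro ballI exI conjI allI impI)
    fix s t assume "s \<in> U" "dist t s < 1"
    moreover have "spin_val t = spin_val s" if "dist t s < 1"
      using that spin_val_cases[of s] spin_val_cases[of t]
      by (auto simp: dist_spin_def dist_real_def)
    ultimately show "t \<in> U" by (simp add: spin_val_inject)
  qed simp
qed

text \<open>
  Configurations are indexed from \<open>0\<close>: the coordinate \<open>x\<^sub>j\<close> of a sequence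
  \<open>(x\<^sub>1, x\<^sub>2, \<dots>)\<close> is \<open>x (j - 1)\<close>. The type carries the product topology.
\<close>

type_synonym config = "nat \<Rightarrow> spin"

lemma compact_config: "compact (UNIV :: config set)"
proof -
  have "compact_space (euclidean :: config topology)"
    unfolding euclidean_product_topology[symmetric] compact_space_product_topology
    by (simp add: compact_space_def compactin_euclidean_iff finite_imp_compact)
  then show ?thesis
    by (simp add: compact_space_def compactin_euclidean_iff)
qed

text \<open>
  Every continuous \<open>f :: config \<Rightarrow> real\<close> is bounded, so \<open>config \<Rightarrow>\<^sub>C real\<close>
  is all of \<open>C(X)\<close>.
\<close>

lemma config_bcontfun:
  fixes f :: "config \<Rightarrow> real"
  assumes "continuous_on UNIV f"
  shows "f \<in> bcontfun"
  using assms compact_config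
  by (auto simp: bcontfun_def intro!: compact_imp_bounded compact_continuous_image)

definition ruelle :: "(config \<Rightarrow> real) \<Rightarrow> (config \<Rightarrow> real) \<Rightarrow> config \<Rightarrow> real"
  where "ruelle A f x = (\<Sum>i\<in>UNIV. exp (A (case_nat i x)) * f (case_nat i x))"

text \<open>Only meaningful for continuous \<open>A\<close>; see \<open>ruelle_op_apply\<close> below.\<close>

definition ruelle_op :: "(config \<Rightarrow> real) \<Rightarrow> (config \<Rightarrow>\<^sub>C real) \<Rightarrow>\<^sub>L (config \<Rightarrow>\<^sub>C real)"
  where "ruelle_op A = Blinfun (\<lambda>f. Bcontfun (ruelle A (apply_bcontfun f)))"

lemma continuous_on_case_nat: "continuous_on UNIV (case_nat i :: config \<Rightarrow> config)"
proof (rule continuous_on_coordinatewise_then_product)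
  fix n
  show "continuous_on UNIV (\<lambda>x :: config. case_nat i x n)"
    by (cases n) simp_all
qed

lemma continuous_on_ruelle:
  assumes A: "continuous_on UNIV A" and f: "continuous_on UNIV f"
  shows "continuous_on UNIV (ruelle A f)"
proof -
  have *: "continuous_on UNIV (\<lambda>x. g (case_nat i x))"
    if "continuous_on UNIV g" for g :: "config \<Rightarrow> real" and i
    using continuous_on_compose2[OF that continuous_on_case_nat] by simp
  show ?thesis
    unfolding ruelle_def by (intro continuous_intros *[OF A] *[OF f])
qed

lemma ruelle_op_apply:
  assumes A: "continuous_on UNIV A"
  shows "apply_bcontfun (blinfun_apply (ruelle_op A) f) = ruelle A (apply_bcontfun f)"
proof -
  let ?T = "\<lambda>f. Bcontfun (ruelle A (apply_bcontfun f))"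
  have app: "apply_bcontfun (?T g) = ruelle A (apply_bcontfun g)" for g
    by (intro Bcontfun_inverse config_bcontfun continuous_on_ruelle A) simp
  have "bounded (range A)"
    using config_bcontfun[OF A] by (simp add: bcontfun_def)
  then obtain M where M: "\<And>x. A x \<le> M"
    by (auto simp: bounded_real) (metis abs_le_D1)
  have "bounded_linear ?T"
  proof (rule bounded_linear_intro)
    show "?T (g + h) = ?T g + ?T h" for g h
      by (rule bcontfun_eqI, simp only: plus_bcontfun.rep_eq[of "?T g" "?T h"] app)
        (simp add: ruelle_def algebra_simps sum.distrib)
    show "?T (r *\<^sub>R g) = r *\<^sub>R ?T g" for r g
      by (rule bcontfun_eqI, simp only: scaleR_bcontfun.rep_eq[of r "?T g"] app)
        (simp add: ruelle_def sum_distrib_left mult.left_commute)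
    show "norm (?T g) \<le> norm g * (\<Sum>i\<in>(UNIV :: spin set). exp M)" for g
    proof (rule norm_bound)
      fix x
      have "norm (exp (A y) * g y) \<le> norm g * exp M" for y
        using norm_bounded[of g y] M[of y]
        by (simp add: abs_mult mult.commute[of "norm g"] mult_mono)
      then show "norm (apply_bcontfun (?T g) x) \<le> norm g * (\<Sum>i\<in>(UNIV :: spin set). exp M)"
        unfolding app ruelle_def sum_distrib_left by (intro sum_norm_le)
    qed
  qed
  then show ?thesis
    by (simp add: ruelle_op_def bounded_linear_Blinfun_apply app)
qed

definition dyson_potential :: "real \<Rightarrow> config \<Rightarrow> real"
  where "dyson_potential \<gamma> x =
    (\<Sum>j. real (Suc j) powr (-\<gamma>) * spin_val (x 0) * spin_val (x (Suc j)))"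

lemma
  assumes "1 < \<gamma>"
  shows summable_dyson_potential:
      "summable (\<lambda>j. real (Suc j) powr (-\<gamma>) * spin_val (x 0) * spin_val (x (Suc j)))"
    and continuous_on_dyson_potential: "continuous_on UNIV (dyson_potential \<gamma>)"
proof -
  let ?t = "\<lambda>j x. real (Suc j) powr (-\<gamma>) * spin_val (x 0) * spin_val (x (Suc j))"
  have s: "summable (\<lambda>j. real (Suc j) powr (-\<gamma>))"
    using assms by (subst summable_Suc_iff) (simp add: summable_real_powr_iff)
  have abs_val: "\<bar>spin_val s\<bar> = 1" for s
    using spin_val_cases[of s] by auto
  have b: "norm (?t j x) \<le> real (Suc j) powr (-\<gamma>)" for j and x :: config
    by (simp add: abs_mult abs_val)
  show "summable (\<lambda>j. ?t j x)"
    by (rule summable_comparison_test'[OF s b])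
  have val: "continuous_on UNIV (\<lambda>x :: config. spin_val (x n))" for n
    by (rule continuous_on_compose2[of UNIV spin_val]) simp_all
  have "uniform_limit UNIV (\<lambda>n x. \<Sum>j<n. ?t j x) (\<lambda>x :: config. \<Sum>j. ?t j x) sequentially"
    by (rule Weierstrass_m_test[OF _ s]) (rule b)
  then have "continuous_on UNIV (\<lambda>x :: config. \<Sum>j. ?t j x)"
    by (rule uniform_limit_theorem[rotated])
      (auto intro!: always_eventually continuous_intros val)
  then show "continuous_on UNIV (dyson_potential \<gamma>)"
    by (simp add: dyson_potential_def[abs_def])
qed

definition alternating_tail :: "config set"
  where "alternating_tail =
    {x. \<exists>N. \<forall>j\<ge>N. spin_val (x j) = - spin_val (x (Suc j))}"

text \<open>
  The spectrum of an operator on a real space is that of its complexification: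
  the pair \<open>(u, v)\<close> stands for \<open>u + \<i>v\<close>, and \<open>complexified_shift T z\<close> is \<open>z - T\<close>
  acting on such vectors.
\<close>

definition complexified_shift ::
    "('a :: real_normed_vector \<Rightarrow>\<^sub>L 'a) \<Rightarrow> complex \<Rightarrow> 'a \<times> 'a \<Rightarrow> 'a \<times> 'a"
  where "complexified_shift T z = (\<lambda>(u, v).
    (Re z *\<^sub>R u - Im z *\<^sub>R v - blinfun_apply T u,
     Im z *\<^sub>R u + Re z *\<^sub>R v - blinfun_apply T v))"

definition spectrum :: "('a :: real_normed_vector \<Rightarrow>\<^sub>L 'a) \<Rightarrow> complex set"
  where "spectrum T =
    {z. \<not> (bij (complexified_shift T z) \<and> bounded_linear (inv (complexified_shift T z)))}"

definition spectral_radius :: "('a :: real_normed_vector \<Rightarrow>\<^sub>L 'a) \<Rightarrow> real"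
  where "spectral_radius T = (SUP z\<in>spectrum T. cmod z)"

end

theory Submission
  imports Defs
begin

text \<open>
  Glue a second half-line \<open>y\<close> to the left of \<open>x\<close> and let \<open>W(x, y)\<close> be the interaction energy between
  the two. If the tail of \<open>x\<close> alternates, cancellation makes the field of \<open>x\<close> at distance \<open>k\<close> of order
  \<open>k powr -\<gamma>\<close>, so \<open>W(x, \<cdot>)\<close> is a continuous function although the two-sided energy diverges in
  general when \<open>\<gamma> < 2\<close>. Moving one site from one half-line to the other gives
  \<open>A(ix) + W(ix, y) = A(iy) + W(x, iy)\<close>. Hence if \<open>\<nu>\<close> is a positive functional with
  \<open>\<nu>(L f) = \<lambda> \<nu>(f)\<close>, then \<open>\<phi>(x) = \<nu>(exp W(x, \<cdot>))\<close> satisfies \<open>L \<phi> = \<lambda> \<phi>\<close>.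

  Such a \<open>\<nu>\<close> exists for the radius of convergence \<open>\<lambda>\<close> of the Neumann series, as a cluster point of
  normalised point evaluations of the resolvent, which blows up as its parameter decreases to \<open>\<lambda>\<close>.
  The existence of \<open>\<nu>\<close> prevents \<open>\<lambda> - L\<close> from being surjective, so \<open>\<lambda>\<close> is the spectral radius.
\<close>

section \<open>The Neumann series in the complexification\<close>

text \<open>Complex scalar multiplication when the pair \<open>(u, v)\<close> stands for u + iv; the
  product type itself carries only real scalars.\<close>

definition complex_scale :: "complex \<Rightarrow> 'a :: real_normed_vector \<times> 'a \<Rightarrow> 'a \<times> 'a"
  where "complex_scale c w =
    (Re c *\<^sub>R fst w - Im c *\<^sub>R snd w, Im c *\<^sub>R fst w + Re c *\<^sub>R snd w)"

lemma complex_scale_1 [simp]: "complex_scale 1 w = w"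
  by (simp add: complex_scale_def)

lemma complex_scale_scale: "complex_scale c (complex_scale d w) = complex_scale (c * d) w"
  by (simp add: complex_scale_def algebra_simps)

text \<open>Multiplication by i, which sends \<open>(u, v)\<close> to \<open>(- v, u)\<close>, is an
  isometry of the product norm. Treating the real and imaginary parts of \<open>c\<close> separately
  costs the factor 2.\<close>

lemma norm_complex_scale_le: "norm (complex_scale c w) \<le> 2 * cmod c * norm w"
proof -
  have "complex_scale c w = Re c *\<^sub>R w + Im c *\<^sub>R (- snd w, fst w)"
    by (cases w) (simp add: complex_scale_def)
  also have "norm \<dots> \<le> \<bar>Re c\<bar> * norm w + \<bar>Im c\<bar> * norm (- snd w, fst w)"
    by (rule order_trans[OF norm_triangle_ineq]) (simp del: scaleR_Pair)
  also have "norm (- snd w, fst w) = norm w"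
    by (cases w) (simp add: norm_Pair add.commute)
  also have "\<bar>Re c\<bar> * norm w + \<bar>Im c\<bar> * norm w \<le> cmod c * norm w + cmod c * norm w"
    by (intro add_mono mult_right_mono abs_Re_le_cmod abs_Im_le_cmod norm_ge_zero)
  finally show ?thesis by simp
qed

lemma bounded_linear_complex_scale: "bounded_linear (complex_scale c)"
  unfolding complex_scale_def[abs_def]
  by (intro bounded_linear_Pair bounded_linear_sub bounded_linear_add bounded_linear_const_scaleR
      bounded_linear_fst bounded_linear_snd)

lemma complexified_shift_eq:
  "complexified_shift T z w = complex_scale z w - map_prod (blinfun_apply T) (blinfun_apply T) w"
  by (cases w) (simp add: complexified_shift_def complex_scale_def)

lemma bounded_linear_funpow:
  fixes T :: "'a :: real_normed_vector \<Rightarrow>\<^sub>L 'a"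
  shows "bounded_linear (blinfun_apply T ^^ n)"
proof (induction n)
  case (Suc n)
  have "blinfun_apply T ^^ Suc n = (\<lambda>u. blinfun_apply T ((blinfun_apply T ^^ n) u))"
    by auto
  then show ?case
    using bounded_linear_compose[OF blinfun.bounded_linear_right Suc.IH] by simp
qed (simp add: id_def)

text \<open>The Neumann series of T^n / z^(n+1) is a bounded two-sided inverse of z - T. The bound
  \<open>b\<close> is left abstract so that the norms of the iterates of a single function can be
  inserted later.\<close>

lemma notin_spectrum_if_summable:
  fixes T :: "'a :: banach \<Rightarrow>\<^sub>L 'a"
  assumes b: "\<And>n u. norm ((blinfun_apply T ^^ n) u) \<le> b n * norm u"
    and sb: "summable (\<lambda>n. b n / cmod z ^ n)" and z: "z \<noteq> 0"
  shows "z \<notin> spectrum T"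
proof -
  let ?D = "complexified_shift T z"
  define T2 where "T2 = map_prod (blinfun_apply T) (blinfun_apply T)"
  define s where "s n w = complex_scale (1 / z ^ n) ((T2 ^^ n) w)" for n w
  define R where "R w = (\<Sum>n. complex_scale (1 / z) (s n w))" for w
  have T2_scale: "T2 (complex_scale c w) = complex_scale c (T2 w)" for c w
    by (simp add: T2_def complex_scale_def blinfun.bilinear_simps)
  have T2_pow: "(T2 ^^ n) w = ((blinfun_apply T ^^ n) (fst w), (blinfun_apply T ^^ n) (snd w))" for n w
    by (induction n) (auto simp: T2_def)
  have bl_T2: "bounded_linear (T2 ^^ n)" for n
    unfolding T2_pow[abs_def]
    by (intro bounded_linear_Pair bounded_linear_compose[OF bounded_linear_funpow]
        bounded_linear_fst bounded_linear_snd)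
  have bl_T2': "bounded_linear T2"
    using bl_T2[of 1] by simp
  have bl_s: "bounded_linear (s n)" for n
    unfolding s_def[abs_def] by (rule bounded_linear_compose[OF bounded_linear_complex_scale bl_T2])
  note bl_cs = bounded_linear_complex_scale
  \<comment> \<open>Nothing is assumed about the sign of \<open>b\<close>, but its bound at any
    nonzero vector forces it to be nonnegative.\<close>
  have b0: "0 \<le> b n" if "u \<noteq> 0" for n and u :: 'a
  proof -
    have "0 \<le> b n * norm u"
      by (rule order_trans[OF norm_ge_zero b])
    then show ?thesis
      using that by (simp add: zero_le_mult_iff)
  qed
  \<comment> \<open>One factor 2 comes from \<open>norm_complex_scale_le\<close>, the other from
    adding the bounds of the two components.\<close>
  have norm_s: "norm (s n w) \<le> 4 * (b n / cmod z ^ n) * norm w" for n w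
  proof (cases "w = 0")
    case True
    then show ?thesis using bl_s[of n] by (simp add: linear_simps)
  next
    case False
    then have b0': "0 \<le> b n" using b0[of "fst w"] b0[of "snd w"] by (auto simp: prod_eq_iff)
    have "norm ((T2 ^^ n) w) \<le> norm ((blinfun_apply T ^^ n) (fst w)) + norm ((blinfun_apply T ^^ n) (snd w))"
      unfolding T2_pow by (rule norm_Pair_le)
    also have "\<dots> \<le> b n * norm w + b n * norm w"
      using norm_fst_le[of "fst w" "snd w"] norm_snd_le[of "snd w" "fst w"] b0'
      by (intro add_mono order_trans[OF b] mult_left_mono) auto
    finally have "norm ((T2 ^^ n) w) \<le> 2 * b n * norm w" by (simp add: mult_ac)
    then have "2 * cmod (1 / z ^ n) * norm ((T2 ^^ n) w) \<le> 2 * cmod (1 / z ^ n) * (2 * b n * norm w)"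
      by (intro mult_left_mono) auto
    then have "norm (s n w) \<le> 2 * cmod (1 / z ^ n) * (2 * b n * norm w)"
      unfolding s_def by (rule order_trans[OF norm_complex_scale_le])
    then show ?thesis by (simp add: norm_divide norm_power)
  qed
  have summ_bd: "summable (\<lambda>n. 4 * (b n / cmod z ^ n) * norm w)" for w :: "'a \<times> 'a"
    by (intro summable_mult summable_mult2 sb)
  have summ: "summable (\<lambda>n. s n w)" for w
    by (rule summable_comparison_test'[OF summ_bd[of w]]) (rule norm_s)
  have R_eq: "R w = complex_scale (1 / z) (\<Sum>n. s n w)" for w
    unfolding R_def by (rule bounded_linear.suminf[OF bl_cs summ, symmetric])
  have bl_sum: "bounded_linear (\<lambda>w. \<Sum>n. s n w)"
  proof (rule bounded_linear_intro)
    show "(\<Sum>n. s n (v + w)) = (\<Sum>n. s n v) + (\<Sum>n. s n w)" for v w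
      using suminf_add[OF summ[of v] summ[of w]] bl_s by (simp add: linear_simps)
    show "(\<Sum>n. s n (r *\<^sub>R w)) = r *\<^sub>R (\<Sum>n. s n w)" for r w
      using suminf_scaleR_right[OF summ[of w], of r] bl_s by (simp add: linear_simps)
    show "norm (\<Sum>n. s n w) \<le> norm w * (\<Sum>n. 4 * (b n / cmod z ^ n))" for w
    proof -
      have sn: "summable (\<lambda>n. norm (s n w))"
        by (rule summable_comparison_test'[OF summ_bd[of w]]) (use norm_s[of _ w] in simp)
      have "norm (\<Sum>n. s n w) \<le> (\<Sum>n. norm (s n w))"
        by (rule summable_norm[OF sn])
      also have "\<dots> \<le> (\<Sum>n. 4 * (b n / cmod z ^ n) * norm w)"
        by (rule suminf_le[OF norm_s sn summ_bd])
      also have "\<dots> = norm w * (\<Sum>n. 4 * (b n / cmod z ^ n))"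
        using suminf_mult2[OF summable_mult[OF sb, of 4], of "norm w"] by (simp add: mult.commute)
      finally show ?thesis .
    qed
  qed
  have bl_R: "bounded_linear R"
    unfolding R_eq[abs_def] by (rule bounded_linear_compose[OF bl_cs bl_sum])
  have T2_s: "T2 (s n w) = complex_scale z (s (Suc n) w)" for n w
    using z by (simp add: s_def T2_scale complex_scale_scale field_simps)
  \<comment> \<open>Both one-sided inverse properties reduce to this telescoping sum, which starts
    at \<open>s 0 w = w\<close> and whose terms tend to 0.\<close>
  have tele: "(\<Sum>n. s n w - s (Suc n) w) = w" for w
    using telescope_sums'[OF summable_LIMSEQ_zero[OF summ[of w]]]
    by (simp add: sums_iff s_def)
  have shift_s: "?D (complex_scale (1 / z) (s n w)) = s n w - s (Suc n) w" for n w
    using z by (simp add: complexified_shift_eq T2_def[symmetric] T2_scale T2_s complex_scale_scale)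
  have bl_D: "bounded_linear ?D"
    unfolding complexified_shift_eq[abs_def] T2_def[symmetric]
    by (intro bounded_linear_sub bl_cs bl_T2')
  have left: "?D (R w) = w" for w
    unfolding R_def
    by (subst bounded_linear.suminf[OF bl_D])
      (simp_all add: shift_s tele bounded_linear.summable[OF bl_cs summ])
  \<comment> \<open>The operator commutes with its iterates and with complex scaling, so applying z
    - T first yields the same telescoping terms.\<close>
  have s_shift: "complex_scale (1 / z) (s n (?D w)) = s n w - s (Suc n) w" for n w
  proof -
    have "s n (complex_scale z w) = complex_scale z (s n w)"
    proof -
      have "(T2 ^^ n) (complex_scale c w) = complex_scale c ((T2 ^^ n) w)" for c
        by (induction n) (auto simp: T2_scale)
      then show ?thesis by (simp add: s_def complex_scale_scale mult.commute)
    qed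
    moreover have "s n (T2 w) = complex_scale z (s (Suc n) w)"
      using T2_s[of n w] by (simp add: s_def T2_scale funpow_swap1)
    ultimately show ?thesis
      using z
      by (simp add: complexified_shift_eq T2_def[symmetric] complex_scale_scale
          linear_diff[OF bounded_linear.linear[OF bl_s]] linear_diff[OF bounded_linear.linear[OF bl_cs]])
  qed
  have right: "R (?D w) = w" for w
    unfolding R_def s_shift by (rule tele)
  have "bij ?D"
    by (rule o_bij[of R]) (auto simp: left right)
  moreover have "inv ?D = R"
    by (rule inv_unique_comp) (auto simp: left right)
  ultimately show ?thesis
    using bl_R by (simp add: spectrum_def)
qed

text \<open>For a real parameter the two components of the complexified shift decouple, so a
  preimage of \<open>(g, 0)\<close> solves the real equation.\<close>

lemma surj_if_notin_spectrum:
  fixes T :: "'a :: real_normed_vector \<Rightarrow>\<^sub>L 'a"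
  assumes "complex_of_real r \<notin> spectrum T"
  shows "\<exists>f. r *\<^sub>R f - blinfun_apply T f = g"
proof -
  have "surj (complexified_shift T (complex_of_real r))"
    using assms by (simp add: spectrum_def bij_is_surj)
  then obtain w where "complexified_shift T (complex_of_real r) w = (g, 0)"
    unfolding surj_def by metis
  then have "r *\<^sub>R fst w - blinfun_apply T (fst w) = g"
    by (cases w) (simp add: complexified_shift_def)
  then show ?thesis ..
qed

section \<open>Eigenfunctionals of positive operators\<close>

lemma bounded_linear_apply_bcontfun:
  "bounded_linear (\<lambda>f :: 'a :: topological_space \<Rightarrow>\<^sub>C 'b :: real_normed_vector. apply_bcontfun f x)"
  by (rule bounded_linear_intro[where K = 1]) (simp_all add: norm_bounded)

instance bcontfun :: (metric_space, banach) banach ..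

text \<open>The uniform lower bound \<open>\<delta>\<close> forces the iterates of the constant one
  to grow at least like \<open>\<delta> ^ n\<close>, which keeps their growth rate positive.\<close>

locale positive_operator =
  fixes T :: "('a :: metric_space \<Rightarrow>\<^sub>C real) \<Rightarrow>\<^sub>L ('a \<Rightarrow>\<^sub>C real)"
    and one :: "'a \<Rightarrow>\<^sub>C real" and \<delta> :: real
  defines "one \<equiv> const_bcontfun 1"
  assumes nonneg: "(\<And>x. 0 \<le> apply_bcontfun f x) \<Longrightarrow> 0 \<le> apply_bcontfun (blinfun_apply T f) x"
    and delta_pos: "0 < \<delta>"
    and delta_le: "\<delta> \<le> apply_bcontfun (blinfun_apply T one) x"
begin

definition iter :: "nat \<Rightarrow> ('a \<Rightarrow>\<^sub>C real) \<Rightarrow> ('a \<Rightarrow>\<^sub>C real)"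
  where "iter n = (blinfun_apply T ^^ n)"

lemma one_apply [simp]: "apply_bcontfun one x = 1"
  by (simp add: one_def const_bcontfun.rep_eq)

lemma iter_0 [simp]: "iter 0 f = f"
  by (simp add: iter_def)

lemma iter_Suc: "iter (Suc n) f = blinfun_apply T (iter n f)"
  by (simp add: iter_def)

lemma iter_Suc2: "iter (Suc n) f = iter n (blinfun_apply T f)"
  by (simp add: iter_def funpow_swap1)

lemma bounded_linear_iter: "bounded_linear (iter n)"
  unfolding iter_def by (rule bounded_linear_funpow)

lemma iter_add: "iter n (f + g) = iter n f + iter n g"
  by (rule linear_add[OF bounded_linear.linear[OF bounded_linear_iter]])

lemma iter_scaleR: "iter n (c *\<^sub>R f) = c *\<^sub>R iter n f"
  by (rule linear_scale[OF bounded_linear.linear[OF bounded_linear_iter]])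

lemma iter_diff: "iter n (f - g) = iter n f - iter n g"
  by (rule linear_diff[OF bounded_linear.linear[OF bounded_linear_iter]])

lemma iter_nonneg: "(\<And>x. 0 \<le> apply_bcontfun f x) \<Longrightarrow> 0 \<le> apply_bcontfun (iter n f) x"
  by (induction n arbitrary: x) (auto simp: iter_Suc intro: nonneg)

lemma iter_mono:
  assumes "\<And>x. apply_bcontfun f x \<le> apply_bcontfun g x"
  shows "apply_bcontfun (iter n f) x \<le> apply_bcontfun (iter n g) x"
  using iter_nonneg[of "g - f" n x] assms by (simp add: iter_diff)

text \<open>Positivity preserves the bounds of \<open>f\<close> by plus and minus
  \<open>norm f\<close> times the constant one.\<close>

lemma abs_iter_le: "\<bar>apply_bcontfun (iter n f) x\<bar> \<le> norm f * apply_bcontfun (iter n one) x"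
proof -
  have f: "\<bar>apply_bcontfun f y\<bar> \<le> norm f" for y
    using norm_bounded[of f y] by simp
  have "apply_bcontfun (iter n f) x \<le> apply_bcontfun (iter n (norm f *\<^sub>R one)) x"
    by (rule iter_mono) (use f abs_le_D1 in auto)
  moreover have "apply_bcontfun (iter n ((- norm f) *\<^sub>R one)) x \<le> apply_bcontfun (iter n f) x"
    by (rule iter_mono) (use f in \<open>auto simp: abs_le_iff minus_le_iff\<close>)
  ultimately show ?thesis
    unfolding iter_scaleR by (simp add: abs_le_iff)
qed

text \<open>A positive operator attains its norm at the constant one, so these are the operator
  norms of the iterates; \<open>norm_iter_le\<close> is the nontrivial half.\<close>

definition growth :: "nat \<Rightarrow> real"
  where "growth n = norm (iter n one)"

lemma growth_nonneg: "0 \<le> growth n"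
  by (simp add: growth_def)

lemma iter_one_le: "apply_bcontfun (iter n one) x \<le> growth n"
  using norm_bounded[of "iter n one" x] by (simp add: growth_def)

lemma norm_iter_le: "norm (iter n f) \<le> growth n * norm f"
proof (rule norm_bound)
  fix x
  have "norm f * apply_bcontfun (iter n one) x \<le> norm f * growth n"
    by (intro mult_left_mono iter_one_le) auto
  then show "norm (apply_bcontfun (iter n f) x) \<le> growth n * norm f"
    using abs_iter_le[of n f x] by (simp add: mult.commute)
qed

lemma growth_le: "growth n \<le> norm T ^ n * norm one"
proof (induction n)
  case (Suc n)
  have "growth (Suc n) \<le> norm T * growth n"
    by (simp add: growth_def iter_Suc norm_blinfun)
  also have "\<dots> \<le> norm T * (norm T ^ n * norm one)"
    by (intro mult_left_mono Suc) auto
  finally show ?case by simp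
qed (simp add: growth_def)

lemma iter_one_ge: "\<delta> ^ n \<le> apply_bcontfun (iter n one) x"
proof (induction n arbitrary: x)
  case (Suc n)
  have "\<delta> * \<delta> ^ n \<le> \<delta> ^ n * apply_bcontfun (blinfun_apply T one) x"
    using delta_le[of x] delta_pos by simp
  also have "\<dots> = apply_bcontfun (iter 1 (\<delta> ^ n *\<^sub>R one)) x"
    by (simp add: iter_scaleR iter_Suc)
  also have "\<dots> \<le> apply_bcontfun (iter 1 (iter n one)) x"
    by (rule iter_mono) (simp add: Suc)
  finally show ?case
    by (simp add: iter_Suc)
qed simp

lemma growth_ge: "\<delta> ^ n \<le> growth n"
  by (rule order_trans[OF iter_one_ge iter_one_le])

section \<open>The radius of convergence of the Neumann series\<close>

definition summable_radii :: "real set"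
  where "summable_radii = {r. 0 < r \<and> summable (\<lambda>n. growth n / r ^ n)}"

text \<open>By the Cauchy-Hadamard formula this is the upper limit of the n-th roots of
  \<open>growth n\<close>.\<close>

definition radius :: real
  where "radius = Inf summable_radii"

text \<open>For \<open>r\<close> below \<open>\<delta>\<close> all terms of the series are at least
  1, so they do not tend to 0.\<close>

lemma summable_radii_ge_delta:
  assumes "r \<in> summable_radii"
  shows "\<delta> \<le> r"
proof (rule ccontr)
  assume "\<not> \<delta> \<le> r"
  have r: "0 < r" "summable (\<lambda>n. growth n / r ^ n)"
    using assms by (auto simp: summable_radii_def)
  have "1 \<le> growth n / r ^ n" for n
  proof -
    have "r ^ n \<le> \<delta> ^ n"
      using \<open>\<not> \<delta> \<le> r\<close> r by (intro power_mono) auto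
    then show ?thesis
      using growth_ge[of n] r by (simp add: le_divide_eq)
  qed
  then have "1 \<le> (0 :: real)"
    by (intro LIMSEQ_le_const[OF summable_LIMSEQ_zero[OF r(2)]]) auto
  then show False by simp
qed

lemma summable_radii_nonempty: "2 * norm T + 1 \<in> summable_radii"
proof -
  let ?r = "2 * norm T + 1"
  have r: "0 < ?r" using norm_ge_zero[of T] by linarith
  have "norm T < ?r" using norm_ge_zero[of T] by linarith
  then have "norm T / ?r < 1"
    using r by (simp only: divide_less_eq_1_pos)
  moreover have "0 \<le> norm T / ?r"
    using r by (intro divide_nonneg_pos) auto
  ultimately have "norm (norm T / ?r) < 1"
    by (simp only: real_norm_def abs_of_nonneg)
  then have "summable (\<lambda>n. (norm T / ?r) ^ n * norm one)"
    by (intro summable_mult2 summable_geometric)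
  then have "summable (\<lambda>n. growth n / ?r ^ n)"
  proof (rule summable_comparison_test')
    show "norm (growth n / ?r ^ n) \<le> (norm T / ?r) ^ n * norm one" for n
      using growth_le[of n] growth_nonneg[of n] r
      by (simp add: power_divide divide_right_mono abs_mult)
  qed
  then show ?thesis
    using r by (simp add: summable_radii_def)
qed

lemma radius_le: "r \<in> summable_radii \<Longrightarrow> radius \<le> r"
  unfolding radius_def
  by (rule cInf_lower) (auto intro!: bdd_belowI[of _ \<delta>] summable_radii_ge_delta)

lemma radius_pos: "0 < radius"
proof -
  have "\<delta> \<le> radius"
    unfolding radius_def
    by (rule cInf_greatest) (use summable_radii_nonempty in \<open>auto intro: summable_radii_ge_delta\<close>)
  then show ?thesis using delta_pos by simp
qed

lemma summable_growth:
  assumes "radius < r"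
  shows "summable (\<lambda>n. growth n / r ^ n)"
proof -
  obtain s where s: "s \<in> summable_radii" "s < r"
    using cInf_lessD[of summable_radii r] summable_radii_nonempty assms
    by (auto simp: radius_def)
  have s': "0 < s" "summable (\<lambda>n. growth n / s ^ n)"
    using s(1) by (auto simp: summable_radii_def)
  show ?thesis
  proof (rule summable_comparison_test'[OF s'(2)])
    show "norm (growth n / r ^ n) \<le> growth n / s ^ n" for n
      using s(2) s'(1) growth_nonneg[of n]
      by (simp add: abs_mult) (intro divide_left_mono power_mono mult_pos_pos zero_less_power; simp)
  qed
qed

lemma notin_spectrum:
  assumes "radius < cmod z"
  shows "z \<notin> spectrum T"
proof (rule notin_spectrum_if_summable[where b = growth])
  show "norm ((blinfun_apply T ^^ n) u) \<le> growth n * norm u" for n u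
    using norm_iter_le[of n u] by (simp add: iter_def)
  show "summable (\<lambda>n. growth n / cmod z ^ n)"
    by (rule summable_growth[OF assms])
  show "z \<noteq> 0"
    using assms radius_pos by auto
qed

section \<open>The resolvent to the right of the radius\<close>

definition resolvent :: "real \<Rightarrow> ('a \<Rightarrow>\<^sub>C real) \<Rightarrow> ('a \<Rightarrow>\<^sub>C real)"
  where "resolvent r f = (\<Sum>n. (1 / r ^ n) *\<^sub>R iter n f)"

context
  fixes r
  assumes r: "radius < r"
begin

lemma r_pos: "0 < r"
  using r radius_pos by simp

lemma summable_resolvent: "summable (\<lambda>n. (1 / r ^ n) *\<^sub>R iter n f)"
proof (rule summable_comparison_test'[OF summable_mult2[OF summable_growth[OF r], of "norm f"]])
  show "norm ((1 / r ^ n) *\<^sub>R iter n f) \<le> growth n / r ^ n * norm f" for n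
    using norm_iter_le[of n f] r_pos by (simp add: divide_right_mono)
qed

lemma resolvent_add: "resolvent r (f + g) = resolvent r f + resolvent r g"
  using suminf_add[OF summable_resolvent[of f] summable_resolvent[of g]]
  by (simp add: resolvent_def iter_add scaleR_add_right)

lemma resolvent_scaleR: "resolvent r (c *\<^sub>R f) = c *\<^sub>R resolvent r f"
  using suminf_scaleR_right[OF summable_resolvent[of f], of c]
  by (simp add: resolvent_def iter_scaleR mult.commute)

lemma summable_resolvent_apply: "summable (\<lambda>n. 1 / r ^ n * apply_bcontfun (iter n f) x)"
  using bounded_linear.summable[OF bounded_linear_apply_bcontfun[of x] summable_resolvent[of f]]
  by simp

lemma resolvent_apply: "apply_bcontfun (resolvent r f) x = (\<Sum>n. 1 / r ^ n * apply_bcontfun (iter n f) x)"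
  unfolding resolvent_def
  by (subst bounded_linear.suminf[OF bounded_linear_apply_bcontfun[of x] summable_resolvent]) simp

lemma resolvent_ge:
  assumes "\<And>x. 0 \<le> apply_bcontfun f x"
  shows "apply_bcontfun f x \<le> apply_bcontfun (resolvent r f) x"
proof -
  have "(\<Sum>n<1. 1 / r ^ n * apply_bcontfun (iter n f) x) \<le> (\<Sum>n. 1 / r ^ n * apply_bcontfun (iter n f) x)"
    by (rule sum_le_suminf[OF summable_resolvent_apply])
      (use iter_nonneg[OF assms] r_pos in auto)
  then show ?thesis by (simp add: resolvent_apply)
qed

lemma resolvent_nonneg:
  "(\<And>x. 0 \<le> apply_bcontfun f x) \<Longrightarrow> 0 \<le> apply_bcontfun (resolvent r f) x"
  by (rule order_trans[OF _ resolvent_ge])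

text \<open>The series is r (r - T)^(-1), normalised so that its zeroth term is \<open>f\<close>;
  splitting off that term gives the resolvent identity.\<close>

lemma resolvent_operator:
  "resolvent r (blinfun_apply T f) = r *\<^sub>R (resolvent r f - f)"
proof -
  have "resolvent r f = f + (\<Sum>n. (1 / r ^ Suc n) *\<^sub>R iter (Suc n) f)"
    using suminf_split_head[OF summable_resolvent[of f]] by (simp add: resolvent_def)
  moreover have "r *\<^sub>R (\<Sum>n. (1 / r ^ Suc n) *\<^sub>R iter (Suc n) f) = resolvent r (blinfun_apply T f)"
    using suminf_scaleR_right[OF summable_Suc_iff[THEN iffD2, OF summable_resolvent[of f]], of r] r_pos
    by (simp add: resolvent_def iter_Suc2)
  ultimately show ?thesis by simp
qed

lemma operator_resolvent:
  "blinfun_apply T (resolvent r f) = r *\<^sub>R (resolvent r f - f)"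
proof -
  have "blinfun_apply T (resolvent r f) = resolvent r (blinfun_apply T f)"
    unfolding resolvent_def
    by (subst bounded_linear.suminf[OF blinfun.bounded_linear_right summable_resolvent])
      (simp add: blinfun.bilinear_simps iter_Suc2[symmetric] iter_Suc)
  then show ?thesis by (simp add: resolvent_operator)
qed

end

text \<open>
  A uniform bound on the resolvent near the radius would make \<open>T / r\<close> a strict contraction
  relative to the function \<open>resolvent r one\<close>, and the series would converge below the radius.
\<close>

lemma resolvent_unbounded:
  assumes eps: "0 < \<epsilon>"
  shows "\<exists>r x. radius < r \<and> r < radius + \<epsilon> \<and> M < apply_bcontfun (resolvent r one) x"
proof (rule ccontr)
  assume neg: "\<not> ?thesis"
  \<comment> \<open>\<open>K\<close> would bound the resolvent of the constant one near the radius;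
    the maximum with 2 places \<open>c\<close>, the contraction factor, strictly between 0 and
    1.\<close>
  define K where "K = max M 2"
  define c where "c = 1 - 1 / K"
  have K: "2 \<le> K" by (simp add: K_def)
  have c: "0 < c" "c < 1" using K by (auto simp: c_def)
  \<comment> \<open>This leaves room for an \<open>r\<close> above \<open>radius\<close> with
    \<open>r * c\<close> still below it.\<close>
  have "radius < radius / c"
    using c radius_pos by (simp add: less_divide_eq)
  with eps obtain r where r: "radius < r" "r < min (radius + \<epsilon>) (radius / c)"
    by (metis dense less_add_same_cancel1 min_less_iff_conj)
  have rc: "r * c < radius"
    using r(2) c by (simp add: less_divide_eq)
  have r0: "0 < r" using r radius_pos by simp
  define H where "H = resolvent r one"
  have H_le: "apply_bcontfun H x \<le> K" for x
    using neg r unfolding H_def K_def by (smt (verit, best) min_less_iff_conj)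
  have H_ge: "1 \<le> apply_bcontfun H x" for x
    using resolvent_ge[OF r(1), of one x] by (simp add: H_def)
  \<comment> \<open>The resolvent identity says T H = r (H - 1), and H / K is at most 1, so
    subtracting 1 removes at least the fraction 1 / K of H.\<close>
  have TH: "apply_bcontfun (blinfun_apply T H) x \<le> apply_bcontfun ((r * c) *\<^sub>R H) x" for x
  proof -
    have "apply_bcontfun H x / K \<le> 1"
      using H_le[of x] K by simp
    then have "apply_bcontfun H x - 1 \<le> c * apply_bcontfun H x"
      by (simp add: c_def algebra_simps)
    then show ?thesis
      using r0 by (simp add: H_def operator_resolvent[OF r(1)] mult.assoc)
  qed
  have TnH: "apply_bcontfun (iter n H) x \<le> (r * c) ^ n * apply_bcontfun H x" for n x
  proof (induction n arbitrary: x)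
    case (Suc n)
    have "apply_bcontfun (iter (Suc n) H) x \<le> apply_bcontfun (iter n ((r * c) *\<^sub>R H)) x"
      unfolding iter_Suc2 by (rule iter_mono[OF TH])
    also have "\<dots> = (r * c) * apply_bcontfun (iter n H) x"
      by (simp add: iter_scaleR)
    also have "\<dots> \<le> (r * c) * ((r * c) ^ n * apply_bcontfun H x)"
      using r0 c by (intro mult_left_mono Suc) auto
    finally show ?case by (simp add: mult_ac)
  qed simp
  have growth_rc: "growth n \<le> (r * c) ^ n * K" for n
    unfolding growth_def
  proof (rule norm_bound)
    fix x
    have "apply_bcontfun (iter n one) x \<le> apply_bcontfun (iter n H) x"
      by (rule iter_mono) (simp add: H_ge)
    also have "\<dots> \<le> (r * c) ^ n * apply_bcontfun H x"
      by (rule TnH)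
    also have "\<dots> \<le> (r * c) ^ n * K"
      using r0 c by (intro mult_left_mono H_le) auto
    finally show "norm (apply_bcontfun (iter n one) x) \<le> (r * c) ^ n * K"
      using iter_nonneg[of one n x] by simp
  qed
  \<comment> \<open>Since \<open>growth n\<close> is of order \<open>(r * c) ^ n\<close>, any such
    \<open>s\<close> is a summable radius below the infimum.\<close>
  obtain s where s: "r * c < s" "s < radius"
    using dense[OF rc] by blast
  have s0: "0 < s"
    using s(1) r0 c by (meson less_trans mult_pos_pos)
  have "summable (\<lambda>n. (r * c / s) ^ n * K)"
    using s s0 r0 c by (intro summable_mult2 summable_geometric) (auto simp: abs_mult)
  then have "summable (\<lambda>n. growth n / s ^ n)"
  proof (rule summable_comparison_test')
    show "norm (growth n / s ^ n) \<le> (r * c / s) ^ n * K" for n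
      using growth_rc[of n] growth_nonneg[of n] s0
      by (simp add: power_divide divide_right_mono)
  qed
  then have "s \<in> summable_radii"
    using s0 by (simp add: summable_radii_def)
  then show False
    using radius_le[of s] s(2) by simp
qed

section \<open>Eigenstates as limits of normalised resolvent evaluations\<close>

definition is_state :: "(('a \<Rightarrow>\<^sub>C real) \<Rightarrow> real) \<Rightarrow> bool"
  where "is_state \<nu> \<longleftrightarrow> linear \<nu> \<and> \<nu> one = 1 \<and>
    (\<forall>f. (\<forall>x. 0 \<le> apply_bcontfun f x) \<longrightarrow> 0 \<le> \<nu> f)"

lemma is_state_mono:
  assumes "is_state \<nu>" and "\<And>x. apply_bcontfun f x \<le> apply_bcontfun g x"
  shows "\<nu> f \<le> \<nu> g"
proof -
  have "0 \<le> \<nu> (g - f)"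
    using assms by (simp add: is_state_def)
  then show ?thesis
    using assms(1) by (simp add: is_state_def linear_diff)
qed

lemma is_state_abs_le:
  assumes "is_state \<nu>"
  shows "\<bar>\<nu> f\<bar> \<le> norm f"
proof -
  have f: "\<bar>apply_bcontfun f y\<bar> \<le> norm f" for y
    using norm_bounded[of f y] by simp
  have "\<nu> f \<le> \<nu> (norm f *\<^sub>R one)"
    by (rule is_state_mono[OF assms]) (use f abs_le_D1 in auto)
  moreover have "\<nu> ((- norm f) *\<^sub>R one) \<le> \<nu> f"
    by (rule is_state_mono[OF assms]) (use f in \<open>auto simp: abs_le_iff minus_le_iff\<close>)
  moreover have "\<nu> (c *\<^sub>R one) = c" for c
    using assms by (simp add: is_state_def linear_scale)
  ultimately have "\<nu> f \<le> norm f" "- norm f \<le> \<nu> f"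
    by metis+
  then show ?thesis
    by (simp add: abs_le_iff)
qed

text \<open>Evaluate the resolvent at a point and divide by its value \<open>G\<close> on the
  constant one. The resolvent identity leaves two errors: the gap between \<open>r\<close> and
  \<open>radius\<close>, and a term of size at most \<open>r / G\<close> times
  \<open>norm f\<close>.\<close>

lemma approximate_eigenstate:
  assumes eps: "0 < \<epsilon>"
  shows "\<exists>\<nu>. is_state \<nu> \<and> (\<forall>f. \<bar>\<nu> (blinfun_apply T f) - radius * \<nu> f\<bar> \<le> \<epsilon> * norm f)"
proof -
  \<comment> \<open>The gap is below \<open>\<epsilon> / 2\<close>. As \<open>r\<close> is below
    \<open>radius + 1\<close>, the lower bound on the resolvent makes \<open>r / G\<close> at most
    \<open>\<epsilon> / 2\<close> as well.\<close>
  obtain r x where r: "radius < r" "r < radius + min 1 (\<epsilon> / 2)"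
    and big: "(radius + 1) * 2 / \<epsilon> < apply_bcontfun (resolvent r one) x"
    using resolvent_unbounded[of "min 1 (\<epsilon> / 2)" "(radius + 1) * 2 / \<epsilon>"] eps by auto
  define G where "G = apply_bcontfun (resolvent r one) x"
  define \<nu> where "\<nu> f = apply_bcontfun (resolvent r f) x / G" for f
  have "0 < (radius + 1) * 2 / \<epsilon>"
    using eps radius_pos by (intro divide_pos_pos mult_pos_pos) auto
  then have G: "0 < G"
    using big by (simp add: G_def)
  have "linear \<nu>"
    by (rule linearI) (simp_all add: \<nu>_def resolvent_add[OF r(1)] resolvent_scaleR[OF r(1)] add_divide_distrib)
  then have st: "is_state \<nu>"
    using G resolvent_nonneg[OF r(1)] by (simp add: is_state_def \<nu>_def G_def[symmetric])
  have "\<bar>\<nu> (blinfun_apply T f) - radius * \<nu> f\<bar> \<le> \<epsilon> * norm f" for f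
  proof -
    have "\<nu> (blinfun_apply T f) - radius * \<nu> f = (r - radius) * \<nu> f - r / G * apply_bcontfun f x"
      by (simp add: \<nu>_def resolvent_operator[OF r(1)] diff_divide_distrib algebra_simps)
    also have "\<bar>\<dots>\<bar> \<le> (r - radius) * \<bar>\<nu> f\<bar> + r / G * \<bar>apply_bcontfun f x\<bar>"
      using abs_triangle_ineq4[of "(r - radius) * \<nu> f" "r / G * apply_bcontfun f x"] r(1) G radius_pos
      by (simp add: abs_mult)
    also have "\<dots> \<le> \<epsilon> / 2 * norm f + \<epsilon> / 2 * norm f"
    proof (intro add_mono mult_mono)
      have "r * 2 \<le> (radius + 1) * 2" using r(2) by simp
      also have "\<dots> \<le> \<epsilon> * G"
        using big eps by (simp add: G_def divide_less_eq mult.commute)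
      finally show "r / G \<le> \<epsilon> / 2"
        using G by (simp add: divide_le_eq)
      show "\<bar>apply_bcontfun f x\<bar> \<le> norm f"
        using norm_bounded[of f x] by simp
    qed (use r eps is_state_abs_le[OF st] in auto)
    finally show ?thesis by simp
  qed
  with st show ?thesis by blast
qed

text \<open>Tychonoff's theorem for a product of compact intervals, as in the proof of
  Banach-Alaoglu; by \<open>is_state_abs_le\<close> the set contains all states.\<close>

lemma compact_dominated_by_norm: "compact {\<nu>. \<forall>f. \<nu> f \<in> {- norm f .. norm (f :: 'a \<Rightarrow>\<^sub>C real)}}"
proof -
  have "compactin (product_topology (\<lambda>_. euclidean) UNIV)
    (PiE UNIV (\<lambda>f. {- norm f .. norm (f :: 'a \<Rightarrow>\<^sub>C real)}))"
    by (subst compactin_PiE) auto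
  then show ?thesis
    by (simp add: euclidean_product_topology PiE_UNIV_domain Pi_def)
qed

text \<open>Linearity, normalisation, positivity and the eigenvalue equation each involve finitely
  many evaluations for fixed arguments, so they survive pointwise limits. On a compact space such as
  \<open>config\<close> a state is integration against a probability measure, by Riesz.\<close>

lemma eigenstate_radius:
  "\<exists>\<nu>. is_state \<nu> \<and> (\<forall>f. \<nu> (blinfun_apply T f) = radius * \<nu> f)"
proof -
  have "\<exists>\<nu>. \<forall>k. is_state (\<nu> k) \<and>
      (\<forall>f. \<bar>\<nu> k (blinfun_apply T f) - radius * \<nu> k f\<bar> \<le> 1 / real (Suc k) * norm f)"
    by (intro choice allI approximate_eigenstate) simp
  then obtain \<nu> where st: "\<And>k. is_state (\<nu> k)"
    and approx: "\<And>k f. \<bar>\<nu> k (blinfun_apply T f) - radius * \<nu> k f\<bar> \<le> 1 / real (Suc k) * norm f"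
    by blast
  define F where "F = filtermap \<nu> sequentially"
  have "F \<noteq> bot"
    by (simp add: F_def filtermap_bot_iff)
  moreover have "\<forall>\<^sub>F \<mu> in F. \<mu> \<in> {\<nu>. \<forall>f. \<nu> f \<in> {- norm f .. norm f}}"
    unfolding F_def eventually_filtermap
    using is_state_abs_le[OF st] by (auto simp: abs_le_iff minus_le_iff)
  ultimately obtain \<mu> where \<mu>: "inf (nhds \<mu>) F \<noteq> bot"
    using compact_dominated_by_norm unfolding compact_filter by blast
  \<comment> \<open>No separability is available to extract a convergent subsequence, so limits are
    taken along a filter finer than the sequence that converges to the cluster point.\<close>
  define E where "E = inf (nhds \<mu>) F"
  have E: "E \<noteq> bot" "E \<le> F" "E \<le> nhds \<mu>"
    using \<mu> by (auto simp: E_def)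
  have lim: "((\<lambda>\<nu>'. \<nu>' f) \<longlongrightarrow> \<mu> f) E" for f
  proof -
    have cont: "continuous_on UNIV (\<lambda>\<nu>' :: ('a \<Rightarrow>\<^sub>C real) \<Rightarrow> real. \<nu>' f)"
      by (rule continuous_on_product_coordinates)
    have "((\<lambda>\<nu>'. \<nu>' f) \<longlongrightarrow> \<mu> f) (nhds \<mu>)"
    proof (rule topological_tendstoI)
      fix S :: "real set"
      assume S: "open S" "\<mu> f \<in> S"
      have "open ((\<lambda>\<nu>' :: ('a \<Rightarrow>\<^sub>C real) \<Rightarrow> real. \<nu>' f) -` S)"
        by (rule open_vimage[OF S(1) cont])
      then show "\<forall>\<^sub>F \<nu>' in nhds \<mu>. \<nu>' f \<in> S"
        unfolding eventually_nhds using S(2) by (intro exI conjI) auto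
    qed
    then show ?thesis by (rule tendsto_mono[OF E(3)])
  qed
  have ev_state: "\<forall>\<^sub>F \<nu>' in E. is_state \<nu>'"
    by (rule filter_leD[OF E(2)]) (simp add: F_def eventually_filtermap st)
  have "is_state \<mu>"
    unfolding is_state_def
  proof (intro conjI allI impI linearI)
    have "\<forall>\<^sub>F \<nu>' in E. \<nu>' one = 1"
      by (rule eventually_mono[OF ev_state]) (simp add: is_state_def)
    then show "\<mu> one = 1"
      by (rule tendsto_unique[OF E(1) lim tendsto_eventually])
    show "\<mu> (f + g) = \<mu> f + \<mu> g" for f g
    proof -
      have "\<forall>\<^sub>F \<nu>' in E. \<nu>' (f + g) = \<nu>' f + \<nu>' g"
        by (rule eventually_mono[OF ev_state]) (simp add: is_state_def linear_add)
      then have "((\<lambda>\<nu>'. \<nu>' f + \<nu>' g) \<longlongrightarrow> \<mu> (f + g)) E"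
        by (rule Lim_transform_eventually[OF lim])
      then show ?thesis
        by (rule tendsto_unique[OF E(1) _ tendsto_add[OF lim lim]])
    qed
    show "\<mu> (c *\<^sub>R f) = c *\<^sub>R \<mu> f" for c f
    proof -
      have "\<forall>\<^sub>F \<nu>' in E. \<nu>' (c *\<^sub>R f) = c *\<^sub>R \<nu>' f"
        by (rule eventually_mono[OF ev_state]) (simp add: is_state_def linear_scale)
      then have "((\<lambda>\<nu>'. c *\<^sub>R \<nu>' f) \<longlongrightarrow> \<mu> (c *\<^sub>R f)) E"
        by (rule Lim_transform_eventually[OF lim])
      then show ?thesis
        by (rule tendsto_unique[OF E(1) _ tendsto_scaleR[OF tendsto_const lim]])
    qed
    show "0 \<le> \<mu> f" if f: "\<forall>x. 0 \<le> apply_bcontfun f x" for f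
    proof -
      have "\<forall>\<^sub>F \<nu>' in E. 0 \<le> \<nu>' f"
        by (rule eventually_mono[OF ev_state]) (use f in \<open>simp add: is_state_def\<close>)
      then show ?thesis
        by (rule tendsto_lowerbound[OF lim _ E(1)])
    qed
  qed
  moreover have "\<mu> (blinfun_apply T f) = radius * \<mu> f" for f
  proof -
    have "(\<lambda>k. \<nu> k (blinfun_apply T f) - radius * \<nu> k f) \<longlonglongrightarrow> 0"
    proof (rule Lim_null_comparison)
      show "\<forall>\<^sub>F k in sequentially. norm (\<nu> k (blinfun_apply T f) - radius * \<nu> k f)
          \<le> 1 / real (Suc k) * norm f"
        using approx by simp
      show "(\<lambda>k. 1 / real (Suc k) * norm f) \<longlonglongrightarrow> 0"
        using tendsto_mult_left_zero[OF LIMSEQ_inverse_real_of_nat] by (simp add: inverse_eq_divide)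
    qed
    then have "((\<lambda>\<nu>'. \<nu>' (blinfun_apply T f) - radius * \<nu>' f) \<longlongrightarrow> 0) F"
      by (simp add: F_def filterlim_filtermap)
    then have "((\<lambda>\<nu>'. \<nu>' (blinfun_apply T f) - radius * \<nu>' f) \<longlongrightarrow> 0) E"
      by (rule tendsto_mono[OF E(2)])
    moreover have "((\<lambda>\<nu>'. \<nu>' (blinfun_apply T f) - radius * \<nu>' f)
        \<longlongrightarrow> \<mu> (blinfun_apply T f) - radius * \<mu> f) E"
      by (intro tendsto_intros lim)
    ultimately have "\<mu> (blinfun_apply T f) - radius * \<mu> f = 0"
      by (intro tendsto_unique[OF E(1)])
    then show ?thesis by simp
  qed
  ultimately show ?thesis by blast
qed

text \<open>The Neumann series excludes the spectrum beyond \<open>radius\<close>. Conversely an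
  eigenstate vanishes on the range of radius - T but not on the constant one, so that operator is
  not surjective.\<close>

lemma spectral_radius_eq: "spectral_radius T = radius"
proof -
  obtain \<nu> where \<nu>: "is_state \<nu>" and eig: "\<And>f. \<nu> (blinfun_apply T f) = radius * \<nu> f"
    using eigenstate_radius by blast
  have in_spec: "complex_of_real radius \<in> spectrum T"
  proof (rule ccontr)
    assume "complex_of_real radius \<notin> spectrum T"
    then obtain f where "radius *\<^sub>R f - blinfun_apply T f = one"
      using surj_if_notin_spectrum by blast
    then have "\<nu> (radius *\<^sub>R f - blinfun_apply T f) = 1"
      using \<nu> by (simp add: is_state_def)
    then show False
      using \<nu> by (simp add: is_state_def linear_diff linear_scale eig)
  qed
  have "cmod z \<le> radius" if "z \<in> spectrum T" for z
    using notin_spectrum[of z] that by force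
  moreover have "radius \<in> cmod ` spectrum T"
    using in_spec radius_pos by (intro image_eqI[where x = "complex_of_real radius"]) auto
  ultimately show ?thesis
    unfolding spectral_radius_def by (intro cSup_eq_maximum) auto
qed

lemma eigenstate: "\<exists>\<nu>. is_state \<nu> \<and> (\<forall>f. \<nu> (blinfun_apply T f) = spectral_radius T * \<nu> f)"
  using eigenstate_radius by (simp add: spectral_radius_eq)

end

section \<open>The Dyson potential\<close>

lemma abs_spin_val [simp]: "\<bar>spin_val s\<bar> = 1"
  using spin_val_cases[of s] by auto

lemma continuous_on_spin_val: "continuous_on S (\<lambda>x :: config. spin_val (x n))"
  by (rule continuous_on_compose2[of UNIV spin_val]) (auto intro: continuous_on_subset[OF continuous_on_product_coordinates])

text \<open>
  The field exerted by \<open>x\<close> on the \<open>k\<close>-th site to the left of it, the nearest site having index \<open>0\<close>.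
\<close>

definition field :: "real \<Rightarrow> config \<Rightarrow> nat \<Rightarrow> real"
  where "field \<gamma> x k = (\<Sum>j. real (Suc (k + j)) powr (-\<gamma>) * spin_val (x j))"

text \<open>The inner sum runs over \<open>x\<close>, where an alternating tail produces
  cancellation. For \<open>\<gamma>\<close> at most 2 the double series does not converge
  absolutely, so the order of summation is part of the definition.\<close>

definition interaction :: "real \<Rightarrow> config \<Rightarrow> config \<Rightarrow> real"
  where "interaction \<gamma> x y = (\<Sum>k. spin_val (y k) * field \<gamma> x k)"

lemma case_nat_alternating_tail:
  assumes "x \<in> alternating_tail"
  shows "case_nat i x \<in> alternating_tail"
proof -
  obtain N where N: "\<And>j. N \<le> j \<Longrightarrow> spin_val (x j) = - spin_val (x (Suc j))"
    using assms unfolding alternating_tail_def by blast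
  have "spin_val (case_nat i x j) = - spin_val (case_nat i x (Suc j))" if "Suc N \<le> j" for j
    using N[of "j - 1"] that by (cases j) auto
  then show ?thesis
    unfolding alternating_tail_def by blast
qed

text \<open>Turns positivity of the eigenfunction on the whole set into the existence of a point
  where it is nonzero.\<close>

lemma alternating_tail_nonempty: "alternating_tail \<noteq> {}"
proof -
  have val: "spin_val (Spin ((-1) ^ n)) = (-1) ^ n" for n
    by (cases "even n") (simp_all add: Spin_inverse)
  have "(\<lambda>n. Spin ((-1) ^ n)) \<in> alternating_tail"
    unfolding alternating_tail_def mem_Collect_eq val by simp
  then show ?thesis by blast
qed

context
  fixes \<gamma> :: real
  assumes gt1: "1 < \<gamma>"
begin

lemma summable_powr_Suc: "summable (\<lambda>j. real (Suc j) powr (-\<gamma>))"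
  using gt1 by (subst summable_Suc_iff) (simp add: summable_real_powr_iff)

lemma powr_antimono: "m \<le> n \<Longrightarrow> real (Suc n) powr (-\<gamma>) \<le> real (Suc m) powr (-\<gamma>)"
  using gt1 by (intro powr_mono2') auto

lemma summable_field: "summable (\<lambda>j. real (Suc (k + j)) powr (-\<gamma>) * spin_val (x j))"
  by (rule summable_comparison_test'[OF summable_powr_Suc])
    (simp add: abs_mult powr_antimono del: of_nat_Suc)

text \<open>The new site sits at distance \<open>Suc k\<close>, and all of \<open>x\<close> moves
  one step further away.\<close>

lemma field_case_nat:
  "field \<gamma> (case_nat i x) k = real (Suc k) powr (-\<gamma>) * spin_val i + field \<gamma> x (Suc k)"
  using suminf_split_head[OF summable_field[of k "case_nat i x"]] by (simp add: field_def)

lemma dyson_potential_eq_field: "dyson_potential \<gamma> (case_nat i x) = spin_val i * field \<gamma> x 0"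
  using suminf_mult[OF summable_field[of 0 x], of "spin_val i"]
  by (simp add: dyson_potential_def field_def mult_ac)

text \<open>
  The alternating part of the series is bounded by its first term, which gains the decay
  in \<open>k\<close> that makes the fields summable.
\<close>

lemma field_le:
  assumes N: "\<And>j. N \<le> j \<Longrightarrow> spin_val (x j) = - spin_val (x (Suc j))"
  shows "\<bar>field \<gamma> x k\<bar> \<le> (real N + 1) * real (Suc k) powr (-\<gamma>)"
proof -
  define a where "a m = real (Suc (k + (m + N))) powr (-\<gamma>)" for m
  have spin: "spin_val (x (m + N)) = (-1) ^ m * spin_val (x N)" for m
  proof (induction m)
    case (Suc m)
    have "spin_val (x (Suc m + N)) = - spin_val (x (m + N))"
      using N[of "m + N"] by (simp only: add_Suc minus_minus)
    then show ?case
      by (simp only: Suc power_Suc)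
  qed simp
  have a0: "0 \<le> a n" and a_mono: "a (Suc n) \<le> a n" for n
    using powr_antimono[of "k + (n + N)" "k + (Suc n + N)"] by (simp_all add: a_def)
  have "a \<longlonglongrightarrow> 0"
    using summable_LIMSEQ_zero[OF summable_powr_Suc, THEN LIMSEQ_ignore_initial_segment, of "k + N"]
    by (simp add: a_def[abs_def] add_ac)
  note leibniz = summable_Leibniz'[OF this a0 a_mono]
  \<comment> \<open>The Leibniz bounds at index 0 place the alternating sum between 0 and
    \<open>a 0\<close>.\<close>
  have tail: "\<bar>\<Sum>m. (-1) ^ m * a m\<bar> \<le> a 0"
    using leibniz(2)[of 0] leibniz(4)[of 0] by simp
  have "field \<gamma> x k = (\<Sum>m. real (Suc (k + (m + N))) powr (-\<gamma>) * spin_val (x (m + N)))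
      + (\<Sum>j<N. real (Suc (k + j)) powr (-\<gamma>) * spin_val (x j))"
    unfolding field_def by (rule suminf_split_initial_segment[OF summable_field])
  also have "(\<Sum>m. real (Suc (k + (m + N))) powr (-\<gamma>) * spin_val (x (m + N)))
      = spin_val (x N) * (\<Sum>m. (-1) ^ m * a m)"
    using suminf_mult[OF leibniz(1), of "spin_val (x N)"] by (simp add: spin a_def mult_ac)
  \<comment> \<open>Each of the \<open>N\<close> spins before the alternation contributes at most
    one leading term and the whole tail at most one more, whence the constant
    \<open>N + 1\<close>.\<close>
  also have "\<bar>\<dots> + (\<Sum>j<N. real (Suc (k + j)) powr (-\<gamma>) * spin_val (x j))\<bar>
      \<le> a 0 + (\<Sum>j<N. real (Suc k) powr (-\<gamma>))"
  proof (rule order_trans[OF abs_triangle_ineq add_mono])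
    show "\<bar>spin_val (x N) * (\<Sum>m. (-1) ^ m * a m)\<bar> \<le> a 0"
      using tail by (simp add: abs_mult)
    show "\<bar>\<Sum>j<N. real (Suc (k + j)) powr (-\<gamma>) * spin_val (x j)\<bar> \<le> (\<Sum>j<N. real (Suc k) powr (-\<gamma>))"
      by (rule order_trans[OF sum_abs sum_mono]) (simp add: abs_mult powr_antimono del: of_nat_Suc)
  qed
  also have "a 0 \<le> real (Suc k) powr (-\<gamma>)"
    unfolding a_def by (rule powr_antimono) simp
  finally show ?thesis by (simp add: algebra_simps)
qed

lemma summable_abs_field:
  assumes "x \<in> alternating_tail"
  shows "summable (\<lambda>k. \<bar>field \<gamma> x k\<bar>)"
proof -
  obtain N where N: "\<And>j. N \<le> j \<Longrightarrow> spin_val (x j) = - spin_val (x (Suc j))"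
    using assms unfolding alternating_tail_def by blast
  show ?thesis
    by (rule summable_comparison_test'[OF summable_mult[OF summable_powr_Suc, of "real N + 1"]])
      (simp only: real_norm_def abs_abs field_le[of N x, OF N])
qed

context
  fixes x
  assumes x: "x \<in> alternating_tail"
begin

lemma interaction_term_le: "norm (spin_val (y k) * field \<gamma> x k) \<le> \<bar>field \<gamma> x k\<bar>"
  by (simp add: abs_mult)

lemma summable_interaction: "summable (\<lambda>k. spin_val (y k) * field \<gamma> x k)"
  by (rule summable_comparison_test'[OF summable_abs_field[OF x] interaction_term_le])

lemma continuous_on_interaction: "continuous_on UNIV (interaction \<gamma> x)"
proof -
  have "uniform_limit UNIV (\<lambda>n y. \<Sum>k<n. spin_val (y k) * field \<gamma> x k)
      (\<lambda>y :: config. \<Sum>k. spin_val (y k) * field \<gamma> x k) sequentially"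
    by (rule Weierstrass_m_test[OF _ summable_abs_field[OF x]]) (rule interaction_term_le)
  then have "continuous_on UNIV (\<lambda>y :: config. \<Sum>k. spin_val (y k) * field \<gamma> x k)"
    by (rule uniform_limit_theorem[rotated])
      (auto intro!: always_eventually continuous_intros continuous_on_spin_val)
  then show ?thesis
    by (simp add: interaction_def[abs_def])
qed

text \<open>
  Both sides are the total energy between the site \<open>i\<close> and the two half-lines \<open>x\<close> and \<open>y\<close>
  on either side of it, together with the energy between the half-lines.
\<close>

lemma interaction_shift:
  "dyson_potential \<gamma> (case_nat i x) + interaction \<gamma> (case_nat i x) y =
   dyson_potential \<gamma> (case_nat i y) + interaction \<gamma> x (case_nat i y)"
proof -
  have s1: "summable (\<lambda>k. spin_val i * (real (Suc k) powr (-\<gamma>) * spin_val (y k)))"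
    using summable_mult[OF summable_field[of 0 y]] by simp
  have s2: "summable (\<lambda>k. spin_val (y k) * field \<gamma> x (Suc k))"
    using summable_Suc_iff[THEN iffD2, OF summable_interaction[of "case_nat i y"]] by simp
  have "interaction \<gamma> (case_nat i x) y =
      (\<Sum>k. spin_val i * (real (Suc k) powr (-\<gamma>) * spin_val (y k)) + spin_val (y k) * field \<gamma> x (Suc k))"
    by (simp add: interaction_def field_case_nat algebra_simps)
  also have "\<dots> = (\<Sum>k. spin_val i * (real (Suc k) powr (-\<gamma>) * spin_val (y k)))
      + (\<Sum>k. spin_val (y k) * field \<gamma> x (Suc k))"
    by (rule suminf_add[OF s1 s2, symmetric])
  also have "(\<Sum>k. spin_val i * (real (Suc k) powr (-\<gamma>) * spin_val (y k))) = dyson_potential \<gamma> (case_nat i y)"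
    by (simp add: dyson_potential_def mult_ac)
  \<comment> \<open>The subtracted head term is the energy between \<open>i\<close> and
    \<open>x\<close>, which is the potential at \<open>case_nat i x\<close>.\<close>
  also have "(\<Sum>k. spin_val (y k) * field \<gamma> x (Suc k))
      = interaction \<gamma> x (case_nat i y) - spin_val i * field \<gamma> x 0"
    using suminf_split_head[OF summable_interaction[of "case_nat i y"]]
    by (simp add: interaction_def)
  finally show ?thesis
    by (simp add: dyson_potential_eq_field)
qed

end

text \<open>With the potential bounded by \<open>M\<close> in absolute value, a single preimage
  already contributes \<open>exp (- M)\<close>.\<close>

lemma positive_operator_dyson: "\<exists>\<delta>. positive_operator (ruelle_op (dyson_potential \<gamma>)) \<delta>"
proof -
  let ?A = "dyson_potential \<gamma>"
  note cont = continuous_on_dyson_potential[OF gt1]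
  have "bounded (range ?A)"
    using config_bcontfun[OF cont] by (simp add: bcontfun_def)
  then obtain M where M: "\<And>x. \<bar>?A x\<bar> \<le> M"
    by (auto simp: bounded_real)
  have "positive_operator (ruelle_op ?A) (exp (- M))"
  proof
    show "0 \<le> apply_bcontfun (blinfun_apply (ruelle_op ?A) f) x"
      if "\<And>x. 0 \<le> apply_bcontfun f x" for f x
      by (auto simp: ruelle_op_apply[OF cont] ruelle_def intro!: sum_nonneg mult_nonneg_nonneg that)
    show "exp (- M) \<le> apply_bcontfun (blinfun_apply (ruelle_op ?A) (const_bcontfun 1)) x" for x
    proof -
      have "exp (- M) \<le> exp (?A (case_nat (Spin 1) x))"
        using M[of "case_nat (Spin 1) x"] by simp
      also have "\<dots> \<le> (\<Sum>i\<in>UNIV. exp (?A (case_nat i x)))"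
        by (rule member_le_sum) auto
      finally show ?thesis
        by (simp add: ruelle_op_apply[OF cont] ruelle_def const_bcontfun.rep_eq)
    qed
  qed simp
  then show ?thesis ..
qed

end

theorem theorem7:
  fixes \<gamma> :: real
  assumes "1 < \<gamma>" and "\<gamma> < 2"
  shows "\<exists>\<phi> :: config \<Rightarrow> real.
    (\<forall>x\<in>alternating_tail. 0 \<le> \<phi> x) \<and>
    (\<exists>x\<in>alternating_tail. \<phi> x \<noteq> 0) \<and>
    (\<forall>x\<in>alternating_tail. ruelle (dyson_potential \<gamma>) \<phi> x =
       spectral_radius (ruelle_op (dyson_potential \<gamma>)) * \<phi> x)"
proof -
  let ?A = "dyson_potential \<gamma>"
  let ?T = "ruelle_op ?A"
  note gt1 = assms(1)
  note cont = continuous_on_dyson_potential[OF gt1]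
  obtain \<delta> where "positive_operator ?T \<delta>"
    using positive_operator_dyson[OF gt1] by blast
  then interpret positive_operator ?T "const_bcontfun 1" \<delta>
    by simp
  obtain \<nu> where \<nu>: "is_state \<nu>"
    and eig: "\<And>f. \<nu> (blinfun_apply ?T f) = spectral_radius ?T * \<nu> f"
    using eigenstate by blast
  have lin: "linear \<nu>"
    using \<nu> by (simp add: is_state_def)
  \<comment> \<open>Outside \<open>alternating_tail\<close> the function under
    \<open>Bcontfun\<close> need not be continuous, and the value is then unspecified;
    \<open>w x\<close> is evaluated only through the next fact.\<close>
  define w where "w x = Bcontfun (\<lambda>y. exp (interaction \<gamma> x y))" for x
  have w: "apply_bcontfun (w x) y = exp (interaction \<gamma> x y)" if "x \<in> alternating_tail" for x y
    unfolding w_def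
    by (subst Bcontfun_inverse)
      (auto intro!: config_bcontfun continuous_intros continuous_on_interaction[OF gt1 that])
  define \<phi> where "\<phi> x = \<nu> (w x)" for x
  have "0 \<le> \<phi> x" if "x \<in> alternating_tail" for x
    using \<nu> by (simp add: is_state_def \<phi>_def w[OF that])
  moreover have "\<phi> x \<noteq> 0" if x: "x \<in> alternating_tail" for x
  proof -
    have "bounded (range (interaction \<gamma> x))"
      using config_bcontfun[OF continuous_on_interaction[OF gt1 x]] by (simp add: bcontfun_def)
    then obtain M where M: "\<And>y. \<bar>interaction \<gamma> x y\<bar> \<le> M"
      by (auto simp: bounded_real)
    \<comment> \<open>A state keeps this uniform lower bound, so the eigenfunction is strictly
      positive on all of \<open>alternating_tail\<close>.\<close>
    have "exp (- M) \<le> exp (interaction \<gamma> x y)" for y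
      using M[of y] by simp
    then have "\<nu> (exp (- M) *\<^sub>R const_bcontfun 1) \<le> \<nu> (w x)"
      by (intro is_state_mono[OF \<nu>]) (simp add: w[OF x])
    also have "\<nu> (exp (- M) *\<^sub>R const_bcontfun 1) = exp (- M)"
      using \<nu> by (simp add: is_state_def linear_scale)
    finally show ?thesis
      using exp_gt_zero[of "- M"] unfolding \<phi>_def by linarith
  qed
  moreover have "ruelle ?A \<phi> x = spectral_radius ?T * \<phi> x" if x: "x \<in> alternating_tail" for x
  proof -
    note ix = case_nat_alternating_tail[OF x]
    have apply_sum: "apply_bcontfun (\<Sum>i\<in>UNIV. c i *\<^sub>R f i) y = (\<Sum>i\<in>UNIV. c i * apply_bcontfun (f i) y)"
      for c :: "spin \<Rightarrow> real" and f :: "spin \<Rightarrow> config \<Rightarrow>\<^sub>C real" and y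
      using linear_sum[OF bounded_linear.linear[OF bounded_linear_apply_bcontfun[of y]], of "\<lambda>i. c i *\<^sub>R f i" UNIV]
      by simp
    have "ruelle ?A \<phi> x = \<nu> (\<Sum>i\<in>UNIV. exp (?A (case_nat i x)) *\<^sub>R w (case_nat i x))"
      by (simp add: ruelle_def \<phi>_def linear_sum[OF lin] linear_scale[OF lin])
    also have "(\<Sum>i\<in>UNIV. exp (?A (case_nat i x)) *\<^sub>R w (case_nat i x)) = blinfun_apply ?T (w x)"
    proof (rule bcontfun_eqI)
      fix y
      have "apply_bcontfun (\<Sum>i\<in>UNIV. exp (?A (case_nat i x)) *\<^sub>R w (case_nat i x)) y =
          (\<Sum>i\<in>UNIV. exp (?A (case_nat i x) + interaction \<gamma> (case_nat i x) y))"
        by (simp add: apply_sum w[OF ix] exp_add)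
      \<comment> \<open>The exponential of \<open>interaction_shift\<close>: summing the kernel over
        the preimages of \<open>x\<close> is the same as applying the Ruelle operator in the
        variable \<open>y\<close>, where the eigenstate acts.\<close>
      also have "\<dots> = apply_bcontfun (blinfun_apply ?T (w x)) y"
        by (simp only: interaction_shift[OF gt1 x] ruelle_op_apply[OF cont] ruelle_def w[OF x] exp_add)
      finally show "apply_bcontfun (\<Sum>i\<in>UNIV. exp (?A (case_nat i x)) *\<^sub>R w (case_nat i x)) y =
        apply_bcontfun (blinfun_apply ?T (w x)) y" .
    qed
    finally show ?thesis
      by (simp only: eig \<phi>_def[symmetric])
  qed
  ultimately show ?thesis
    using alternating_tail_nonempty by blast
qed

end
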